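(* Let $W$ be an infinite, irreducible Coxeter group with simple generators $s_1,\dots,s_n$, let $c$ be a Coxeter element of $W$, and let $x_1x_2\cdots x_N$ be any $c$-admissible sequence. Then the word $s_{x_1}s_{x_2}\cdots s_{x_N}$ is reduced.
   Context: $W$ is a Coxeter group of finite rank $n$: generated by $s_1,\dots,s_n$ subject to $s_i^2=1$ and $(s_is_j)^{m_{ij}}=1$ for $i\ne j$, $2\le m_{ij}=m_{ji}\le\infty$. Its Dynkin diagram $\Gamma$ has vertices $1,\dots,n$ and an edge $\{i,j\}$ whenever $m_{ij}\ne 2$; irreducible means $\Gamma$ is connected. A Coxeter element is an element of the form $s_{y_1}\cdots s_{y_n}$ with $y_1\cdots y_n$ a permutation of $\{1,\dots,n\}$. For a Coxeter element $c$, a vertex $x$ is called initial in $c$ if $c=s_{y_1}\cdots s_{y_n}$ for some permutation with $y_1=x$; in that case $s_xcs_x$ is again a Coxeter element. (Equivalently, orient each edge $\{i,j\}$ of $\Gamma$ from $j$ to $i$ when $s_i$ precedes $s_j$ in an expression of $c$; then $x$ is initial iff it is a sink, and passing to $s_xcs_x$ reverses all edges into $x$.) A sequence $x_1,\dots,x_N$ of vertices is $c$-admissible if, setting $c_0=c$ and $c_k=s_{x_k}c_{k-1}s_{x_k}$, each $x_k$ is initial in $c_{k-1}$ for $k=1,\dots,N$. A word is reduced if its number of letters equals the length of the element it represents. *)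

theory Defs
  imports Main "HOL-Library.Extended_Nat"
begin

text \<open>A Coxeter system of rank n with generators s_1..s_n indexed by 1..n.
  The Coxeter matrix is m :: nat => nat => enat, with m i j = \<infinity> meaning no relation.
  Elements of W are represented by words (lists of indices in {1..n}); two words
  represent the same element iff they are equivalent under the congruence generated
  by the defining relators s_i s_i and (s_i s_j)^(m_ij) (finite m_ij).
  Since all generators are involutions this monoid presentation presents W.\<close>

definition coxeter_matrix :: "nat \<Rightarrow> (nat \<Rightarrow> nat \<Rightarrow> enat) \<Rightarrow> bool" where
  "coxeter_matrix n m \<longleftrightarrow>
     (\<forall>i\<in>{1..n}. \<forall>j\<in>{1..n}. i \<noteq> j \<longrightarrow> m i j = m j i \<and> 2 \<le> m i j)"

fun alt :: "nat \<Rightarrow> nat \<Rightarrow> nat \<Rightarrow> nat list" where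
  "alt i j 0 = []"
| "alt i j (Suc k) = i # alt j i k"

definition relator :: "nat \<Rightarrow> (nat \<Rightarrow> nat \<Rightarrow> enat) \<Rightarrow> nat list \<Rightarrow> bool" where
  "relator n m r \<longleftrightarrow>
     (\<exists>i\<in>{1..n}. r = [i, i]) \<or>
     (\<exists>i\<in>{1..n}. \<exists>j\<in>{1..n}. \<exists>k. i \<noteq> j \<and> m i j = enat k \<and> r = alt i j (2 * k))"

definition cstep :: "nat \<Rightarrow> (nat \<Rightarrow> nat \<Rightarrow> enat) \<Rightarrow> nat list \<Rightarrow> nat list \<Rightarrow> bool" where
  "cstep n m u v \<longleftrightarrow> (\<exists>a b r. relator n m r \<and> u = a @ r @ b \<and> v = a @ b)"

definition weq :: "nat \<Rightarrow> (nat \<Rightarrow> nat \<Rightarrow> enat) \<Rightarrow> nat list \<Rightarrow> nat list \<Rightarrow> bool" where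
  "weq n m = equivclp (cstep n m)"

definition is_word :: "nat \<Rightarrow> nat list \<Rightarrow> bool" where
  "is_word n w \<longleftrightarrow> set w \<subseteq> {1..n}"

definition coxeter_infinite :: "nat \<Rightarrow> (nat \<Rightarrow> nat \<Rightarrow> enat) \<Rightarrow> bool" where
  "coxeter_infinite n m \<longleftrightarrow> infinite ((\<lambda>w. {v. weq n m w v}) ` {w. is_word n w})"

definition dynkin_edge :: "nat \<Rightarrow> (nat \<Rightarrow> nat \<Rightarrow> enat) \<Rightarrow> nat \<Rightarrow> nat \<Rightarrow> bool" where
  "dynkin_edge n m i j \<longleftrightarrow> i \<in> {1..n} \<and> j \<in> {1..n} \<and> i \<noteq> j \<and> m i j \<noteq> 2"

definition irreducible_cox :: "nat \<Rightarrow> (nat \<Rightarrow> nat \<Rightarrow> enat) \<Rightarrow> bool" where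
  "irreducible_cox n m \<longleftrightarrow> (\<forall>i\<in>{1..n}. \<forall>j\<in>{1..n}. (dynkin_edge n m)\<^sup>*\<^sup>* i j)"

definition perm_word :: "nat \<Rightarrow> nat list \<Rightarrow> bool" where
  "perm_word n ys \<longleftrightarrow> distinct ys \<and> set ys = {1..n}"

definition coxeter_element :: "nat \<Rightarrow> (nat \<Rightarrow> nat \<Rightarrow> enat) \<Rightarrow> nat list \<Rightarrow> bool" where
  "coxeter_element n m c \<longleftrightarrow> (\<exists>ys. perm_word n ys \<and> weq n m c ys)"

definition initial :: "nat \<Rightarrow> (nat \<Rightarrow> nat \<Rightarrow> enat) \<Rightarrow> nat list \<Rightarrow> nat \<Rightarrow> bool" where
  "initial n m c x \<longleftrightarrow> (\<exists>ys. perm_word n (x # ys) \<and> weq n m c (x # ys))"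

fun admissible :: "nat \<Rightarrow> (nat \<Rightarrow> nat \<Rightarrow> enat) \<Rightarrow> nat list \<Rightarrow> nat list \<Rightarrow> bool" where
  "admissible n m c [] = True"
| "admissible n m c (x # xs) = (initial n m c x \<and> admissible n m (x # c @ [x]) xs)"

definition reduced :: "nat \<Rightarrow> (nat \<Rightarrow> nat \<Rightarrow> enat) \<Rightarrow> nat list \<Rightarrow> bool" where
  "reduced n m w \<longleftrightarrow> (\<forall>v. weq n m w v \<longrightarrow> length w \<le> length v)"

end

theory Submission
  imports Defs Complex_Main
begin

text \<open>
  The admissible sequences are those that successively flip sources of the orientation of the
  Dynkin diagram given by \<open>c\<close>.  Following Speyer, an orientation defines a skew form on the
  root space that is carried along by the reflection in a source and for which a source pairs
  nonnegatively with every nonnegative vector.  If \<open>w\<close> is the element of a reduced admissible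
  word, this forces the right descents of \<open>w\<close> to be closed upwards in the final orientation.
  If the word could be extended admissibly by a right descent \<open>l\<close>, keep appending sources that
  are not descents; since \<open>l\<close> is never flipped and the diagram is connected, this stops.  Then all
  sources are descents, hence so are all generators, so \<open>w\<close> is a longest element and the group is
  finite.
\<close>

section \<open>Words and reduced words\<close>

locale coxeter_system =
  fixes n :: nat and m :: "nat \<Rightarrow> nat \<Rightarrow> enat"
  assumes matrix: "coxeter_matrix n m"
begin

abbreviation word_eq (infix "\<approx>" 50) where "u \<approx> v \<equiv> weq n m u v"
abbreviation edge where "edge \<equiv> dynkin_edge n m"
abbreviation red where "red \<equiv> reduced n m"

lemma weq_refl [simp]: "u \<approx> u"
  by (simp add: weq_def)

lemma weq_sym: "u \<approx> v \<Longrightarrow> v \<approx> u"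
  by (simp add: weq_def equivclp_sym)

lemma weq_trans [trans]: "u \<approx> v \<Longrightarrow> v \<approx> w \<Longrightarrow> u \<approx> w"
  unfolding weq_def by (rule equivclp_trans)

text \<open>The range of the letters, the parity of the length and the action on vectors are all
  carried along word equality this way, by checking one relator deletion.\<close>

lemma weq_invariant:
  assumes "\<And>u v. cstep n m u v \<Longrightarrow> f u = f v" and "u \<approx> v"
  shows "f u = f v"
  using assms(2) unfolding weq_def
  by (induction rule: equivclp_induct) (use assms(1) in fastforce)+

lemma weq_context:
  assumes "u \<approx> v"
  shows "a @ u @ b \<approx> a @ v @ b"
proof -
  have step: "a @ u @ b \<approx> a @ v @ b" if "cstep n m u v" for u v
  proof -
    from that obtain p q r where r: "relator n m r" "u = p @ r @ q" "v = p @ q"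
      unfolding cstep_def by blast
    have "a @ u @ b = (a @ p) @ r @ (q @ b)" "a @ v @ b = (a @ p) @ (q @ b)"
      using r by simp_all
    then have "cstep n m (a @ u @ b) (a @ v @ b)"
      using r(1) unfolding cstep_def by blast
    then show ?thesis unfolding weq_def by (rule r_into_equivclp)
  qed
  show ?thesis
    using assms unfolding weq_def
  proof (induction rule: equivclp_induct)
    case base
    show ?case by simp
  next
    case (step y z)
    then show ?case
      using \<open>\<And>u v. cstep n m u v \<Longrightarrow> a @ u @ b \<approx> a @ v @ b\<close> weq_sym weq_trans
      unfolding weq_def by blast
  qed
qed

lemma weq_append: "u \<approx> u' \<Longrightarrow> v \<approx> v' \<Longrightarrow> u @ v \<approx> u' @ v'"
  using weq_context[of u u' "[]" v] weq_context[of v v' u' "[]"] weq_trans by simp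

lemma weq_relator: "relator n m r \<Longrightarrow> r \<approx> []"
  unfolding weq_def by (rule r_into_equivclp) (force simp: cstep_def)

lemma weq_square: "i \<in> {1..n} \<Longrightarrow> [i, i] \<approx> []"
  by (rule weq_relator) (simp add: relator_def)

lemma weq_cancel: "i \<in> {1..n} \<Longrightarrow> a @ i # i # b \<approx> a @ b"
  using weq_context[OF weq_square, of i a b] by simp

lemma weq_rev_cancel: "set w \<subseteq> {1..n} \<Longrightarrow> rev w @ w \<approx> []"
proof (induction w)
  case (Cons i w)
  then have "rev w @ i # i # w \<approx> rev w @ w" by (intro weq_cancel) auto
  then show ?case using Cons weq_trans by fastforce
qed simp

lemma length_alt [simp]: "length (alt i j k) = k"
  by (induction k arbitrary: i j) auto

lemma set_alt: "set (alt i j k) \<subseteq> {i, j}"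
  by (induction k arbitrary: i j) force+

lemma relator_set: "relator n m r \<Longrightarrow> set r \<subseteq> {1..n}"
  using set_alt unfolding relator_def by fastforce

lemma weq_set:
  assumes "u \<approx> v"
  shows "set u \<subseteq> {1..n} \<longleftrightarrow> set v \<subseteq> {1..n}"
proof (rule weq_invariant[where f = "\<lambda>w. set w \<subseteq> {1..n}", OF _ assms])
  fix u v assume "cstep n m u v"
  then obtain a b r where "relator n m r" "u = a @ r @ b" "v = a @ b"
    unfolding cstep_def by blast
  then show "(set u \<subseteq> {1..n}) = (set v \<subseteq> {1..n})"
    using relator_set[of r] by (simp only: set_append) blast
qed

text \<open>Relators have even length. This takes the place of the sign character.\<close>

lemma weq_parity: "u \<approx> v \<Longrightarrow> even (length u) \<longleftrightarrow> even (length v)"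
  by (rule weq_invariant[where f = "\<lambda>w. even (length w)"]) (auto simp: cstep_def relator_def)

lemma matrix_sym: "i \<in> {1..n} \<Longrightarrow> j \<in> {1..n} \<Longrightarrow> m i j = m j i"
  using matrix unfolding coxeter_matrix_def by (cases "i = j") auto

lemma matrix_ge2: "i \<in> {1..n} \<Longrightarrow> j \<in> {1..n} \<Longrightarrow> i \<noteq> j \<Longrightarrow> 2 \<le> m i j"
  using matrix unfolding coxeter_matrix_def by auto

lemma edge_sym: "edge i j \<Longrightarrow> edge j i"
  using matrix_sym unfolding dynkin_edge_def by metis

lemma alt_add: "alt i j (k + l) = alt i j k @ (if even k then alt i j l else alt j i l)"
  by (induction k arbitrary: i j) auto

lemma rev_alt: "rev (alt i j k) = (if even k then alt j i k else alt i j k)"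
proof (induction k arbitrary: i j)
  case (Suc k)
  have "alt a b (Suc k) = alt a b k @ (if even k then [a] else [b])" for a b
    using alt_add[of a b k 1] by simp
  then show ?case using Suc by auto
qed simp

text \<open>Reversing a word inverts it, and \<open>alt i j (2 * k)\<close> is
  \<open>alt i j k\<close> followed by the reversal of \<open>alt j i k\<close>, whatever the parity
  of \<open>k\<close>.\<close>

lemma alt_braid:
  assumes "i \<in> {1..n}" "j \<in> {1..n}" "i \<noteq> j" "m i j = enat k"
  shows "alt i j k \<approx> alt j i k"
proof -
  have split: "alt i j (2 * k) = alt i j k @ rev (alt j i k)"
    by (simp add: mult_2 alt_add rev_alt)
  have "alt i j k @ rev (alt j i k) @ alt j i k \<approx> alt i j k @ [] @ []"
    using weq_context[OF weq_rev_cancel, of "alt j i k" "alt i j k" "[]"] set_alt[of j i k] assms(1,2)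
    by fastforce
  moreover have "relator n m (alt i j (2 * k))" using assms unfolding relator_def by blast
  then have "alt i j (2 * k) @ alt j i k \<approx> [] @ alt j i k"
    by (intro weq_append weq_relator weq_refl)
  ultimately have "alt i j k \<approx> alt i j (2 * k) @ alt j i k" "alt i j (2 * k) @ alt j i k \<approx> alt j i k"
    unfolding split by (simp_all add: weq_sym)
  then show ?thesis by (rule weq_trans)
qed

text \<open>For non-adjacent generators the braid relation has length 2 and is a commutation, so
  \<open>x\<close> passes through \<open>p\<close> one letter at a time.\<close>

lemma weq_commute:
  assumes "x \<in> {1..n}" "set p \<subseteq> {1..n}" "x \<notin> set p" "\<forall>y\<in>set p. \<not> edge x y"
  shows "p @ [x] \<approx> x # p"
  using assms
proof (induction p)
  case (Cons y p)
  have "m y x = enat 2"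
    using Cons.prems matrix_sym[of x y] by (auto simp: dynkin_edge_def numeral_eq_enat)
  then have "alt y x 2 \<approx> alt x y 2"
    using Cons.prems by (intro alt_braid) auto
  then have "[y, x] \<approx> [x, y]" by (simp add: numeral_2_eq_2)
  then have "[] @ [y, x] @ p \<approx> [] @ [x, y] @ p" by (rule weq_context)
  moreover have "[y] @ (p @ [x]) @ [] \<approx> [y] @ (x # p) @ []"
    by (rule weq_context) (use Cons in auto)
  ultimately show ?case using weq_trans by fastforce
qed simp

lemma red_weq: "red u \<Longrightarrow> u \<approx> v \<Longrightarrow> length v \<le> length u \<Longrightarrow> red v"
  unfolding reduced_def by (meson le_trans weq_trans)

lemma red_infix:
  assumes "red (a @ u @ b)"
  shows "red u"
  unfolding reduced_def
proof (intro allI impI)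
  fix v assume "u \<approx> v"
  then have "length (a @ u @ b) \<le> length (a @ v @ b)"
    using assms weq_context unfolding reduced_def by blast
  then show "length u \<le> length v" by simp
qed

lemma red_prefix: "red (u @ b) \<Longrightarrow> red u"
  using red_infix[of "[]"] by simp

lemma red_suffix: "red (a @ u) \<Longrightarrow> red u"
  using red_infix[of _ _ "[]"] by simp

lemma ex_red: "\<exists>v. w \<approx> v \<and> red v"
proof -
  obtain v where "w \<approx> v" "\<forall>u. w \<approx> u \<longrightarrow> length v \<le> length u"
    using ex_has_least_nat[of "\<lambda>v. w \<approx> v" w length] weq_refl by blast
  then show ?thesis unfolding reduced_def using weq_trans by blast
qed

text \<open>A shorter word \<open>v\<close> for \<open>w @ [s]\<close> has at most
  \<open>length w\<close> letters; minimality of \<open>w\<close> and parity leave only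
  \<open>length w - 1\<close>. Thus a right descent can be made the last letter of a reduced
  word.\<close>

lemma not_red_snoc:
  assumes "red w" "\<not> red (w @ [s])" "s \<in> {1..n}"
  obtains v where "v \<approx> w @ [s]" "v @ [s] \<approx> w" "length w = Suc (length v)" "red (v @ [s])"
proof -
  obtain v where v: "w @ [s] \<approx> v" "length v < length (w @ [s])"
    using assms(2) unfolding reduced_def by (auto simp: not_le)
  have "v @ [s] \<approx> (w @ [s]) @ [s]" using v(1) weq_append weq_sym weq_refl by blast
  then have vs: "v @ [s] \<approx> w"
    using weq_cancel[OF assms(3), of w "[]"] weq_trans by fastforce
  have "length w \<le> length (v @ [s])"
    using vs assms(1) weq_sym unfolding reduced_def by blast
  moreover have "even (length v) \<longleftrightarrow> even (length (w @ [s]))"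
    using weq_parity[OF v(1)] by simp
  ultimately have len: "length w = Suc (length v)"
    using v(2) by (auto simp: le_Suc_eq less_Suc_eq_le)
  show ?thesis
    using that[of v] v(1) vs len weq_sym red_weq[OF assms(1) weq_sym[OF vs]] by auto
qed

lemma red_singleton: "red [s]"
  unfolding reduced_def
proof (intro allI impI)
  fix v assume "[s] \<approx> v"
  then show "length [s] \<le> length v" using weq_parity by (cases v) fastforce+
qed

lemma red_no_repeat: "i \<in> {1..n} \<Longrightarrow> \<not> red (a @ i # i # b)"
  using weq_cancel[of i a b] unfolding reduced_def by fastforce

text \<open>In the prefix of length \<open>k + 1\<close> the braid relation turns the tail
  \<open>alt j i k\<close> into \<open>alt i j k\<close>, which puts two letters \<open>i\<close>
  side by side.\<close>

lemma not_red_alt: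
  assumes "i \<in> {1..n}" "j \<in> {1..n}" "i \<noteq> j" "m i j = enat k" "k < l"
  shows "\<not> red (alt i j l)"
proof
  assume "red (alt i j l)"
  then have "red (alt i j (Suc k))"
    using alt_add[of i j "Suc k" "l - Suc k"] assms(5) red_prefix by auto
  moreover have "[i] @ alt j i k @ [] \<approx> [i] @ alt i j k @ []"
    by (rule weq_context, rule weq_sym, rule alt_braid) (use assms in auto)
  ultimately have "red (i # alt i j k)" using red_weq by fastforce
  moreover obtain k' where "k = Suc k'"
    using matrix_ge2[OF assms(1-3)] assms(4) by (cases k) (auto simp: numeral_eq_enat)
  ultimately show False using red_no_repeat[OF assms(1), of "[]"] by simp
qed

lemma red_two_letters_alt:
  assumes "red u" "set u \<subseteq> {i, j}" "i \<in> {1..n}" "j \<in> {1..n}" "i \<noteq> j"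
  shows "u = alt i j (length u) \<or> u = alt j i (length u)"
  using assms(1,2)
proof (induction u)
  case (Cons x u)
  have "red u" using red_suffix[of "[x]" u] Cons.prems by simp
  then have u: "u = alt i j (length u) \<or> u = alt j i (length u)" using Cons by simp
  show ?case
  proof (cases u)
    case Nil
    then show ?thesis using Cons.prems by auto
  next
    case (Cons y u')
    have "x \<noteq> y"
    proof
      assume "x = y"
      then have "red ([] @ x # x # u')" using Cons.prems(1) Cons by simp
      then show False using red_no_repeat[of x "[]"] Cons.prems(2) assms(3,4) by auto
    qed
    then show ?thesis using Cons.prems(2) u Cons by auto
  qed
qed simp

section \<open>The geometric representation\<close>

text \<open>The weights are \<open>-2 B(\<alpha>\<^sub>i, \<alpha>\<^sub>j)\<close> for the Tits form \<open>B\<close>; vectors are their coordinate functions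
  in the basis of simple roots.\<close>

definition weight :: "nat \<Rightarrow> nat \<Rightarrow> real" where
  "weight i j = (if i = j then 0 else case m i j of enat k \<Rightarrow> 2 * cos (pi / k) | \<infinity> \<Rightarrow> 2)"

text \<open>The reflection \<open>v - 2 B(\<alpha>\<^sub>i, v) \<alpha>\<^sub>i\<close>. The
  diagonal of the form contributes \<open>- 2 * v i\<close>, leaving \<open>- v i\<close>; the sum
  sees only the other coordinates because \<open>weight i i = 0\<close>.\<close>

definition reflect :: "nat \<Rightarrow> (nat \<Rightarrow> real) \<Rightarrow> nat \<Rightarrow> real" where
  "reflect i v = v(i := (\<Sum>j\<in>{1..n}. weight i j * v j) - v i)"

fun act :: "nat list \<Rightarrow> (nat \<Rightarrow> real) \<Rightarrow> nat \<Rightarrow> real" where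
  "act [] v = v"
| "act (i # w) v = reflect i (act w v)"

definition simple_root :: "nat \<Rightarrow> nat \<Rightarrow> real" where
  "simple_root i = (\<lambda>j. if j = i then 1 else 0)"

lemma weight_self [simp]: "weight i i = 0"
  by (simp add: weight_def)

lemma weight_sym: "i \<in> {1..n} \<Longrightarrow> j \<in> {1..n} \<Longrightarrow> weight i j = weight j i"
  unfolding weight_def using matrix_sym by metis

lemma weight_nonneg:
  assumes "i \<in> {1..n}" "j \<in> {1..n}"
  shows "0 \<le> weight i j"
proof (cases "i = j \<or> m i j = \<infinity>")
  case False
  then obtain k where k: "m i j = enat k" "i \<noteq> j" by auto
  then have "2 \<le> k" using matrix_ge2[OF assms] by (simp add: numeral_eq_enat)
  then have "pi / k \<le> pi / 2" by (intro divide_left_mono) auto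
  then have "0 \<le> cos (pi / k)" by (intro cos_ge_zero) (auto intro: order_trans[of _ 0])
  then show ?thesis using k by (simp add: weight_def)
qed (auto simp: weight_def)

lemma weight_pos:
  assumes "edge i j"
  shows "0 < weight i j"
proof (cases "m i j = \<infinity>")
  case False
  have ij: "i \<in> {1..n}" "j \<in> {1..n}" "i \<noteq> j" using assms by (auto simp: dynkin_edge_def)
  obtain k where k: "m i j = enat k" using False by auto
  then have "2 < real k"
    using matrix_ge2[OF ij] assms by (auto simp: dynkin_edge_def numeral_eq_enat)
  then have "pi / k < pi / 2" by (intro divide_strict_left_mono) auto
  then have "0 < cos (pi / k)" by (intro cos_gt_zero_pi) (auto intro: order_less_le_trans[of _ 0])
  then show ?thesis using k ij by (simp add: weight_def)
qed (use assms in \<open>auto simp: weight_def dynkin_edge_def\<close>)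

lemma weight_zero:
  assumes "i \<in> {1..n}" "j \<in> {1..n}" "\<not> edge i j"
  shows "weight i j = 0"
proof (cases "i = j")
  case False
  then have "m i j = enat 2" using assms by (auto simp: dynkin_edge_def numeral_eq_enat)
  then show ?thesis by (simp add: weight_def)
qed simp

lemma reflect_linear:
  "reflect i (\<lambda>k. c * u k + d * v k) = (\<lambda>k. c * reflect i u k + d * reflect i v k)"
  by (rule ext) (simp add: reflect_def sum.distrib sum_distrib_left algebra_simps)

lemma act_linear:
  "act w (\<lambda>k. c * u k + d * v k) = (\<lambda>k. c * act w u k + d * act w v k)"
  by (induction w) (simp_all add: reflect_linear)

lemma act_scale: "act w (\<lambda>k. c * u k) = (\<lambda>k. c * act w u k)"
  using act_linear[of w c u 0 u] by simp

lemma act_append: "act (u @ v) x = act u (act v x)"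
  by (induction u) simp_all

lemma reflect_reflect: "reflect i (reflect i v) = v"
proof -
  have "(\<Sum>j\<in>{1..n}. weight i j * (if j = i then c else v j)) = (\<Sum>j\<in>{1..n}. weight i j * v j)" for c
    by (rule sum.cong) auto
  then show ?thesis by (auto simp: reflect_def fun_upd_def)
qed

lemma act_rev: "act (rev w) (act w v) = v"
  by (induction w arbitrary: v) (simp_all add: act_append reflect_reflect)

lemma reflect_simple_root: "reflect i (simple_root i) = (\<lambda>k. - simple_root i k)"
proof -
  have "(\<Sum>j\<in>{1..n}. weight i j * simple_root i j) = 0"
    by (rule sum.neutral) (simp add: simple_root_def)
  then show ?thesis by (auto simp: reflect_def simple_root_def)
qed

lemma act_snoc_simple_root: "act (w @ [i]) (simple_root i) = (\<lambda>k. - act w (simple_root i) k)"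
  using act_scale[of w "-1" "simple_root i"] by (simp add: act_append reflect_simple_root)

text \<open>Vectors are functions on all naturals, so the support condition is what makes
  \<open>v\<close> a combination of simple roots.\<close>

lemma act_expand:
  assumes "\<forall>j. j \<notin> {1..n} \<longrightarrow> v j = 0"
  shows "act w v k = (\<Sum>j\<in>{1..n}. v j * act w (simple_root j) k)"
proof (induction w arbitrary: k)
  case Nil
  have "(\<Sum>j\<in>{1..n}. v j * simple_root j k) = (\<Sum>j\<in>{1..n}. if k = j then v j else 0)"
    by (rule sum.cong) (auto simp: simple_root_def)
  then show ?case using assms by simp
next
  case (Cons i w)
  have "(\<Sum>l\<in>{1..n}. weight i l * act w v l)
      = (\<Sum>l\<in>{1..n}. \<Sum>j\<in>{1..n}. v j * (weight i l * act w (simple_root j) l))"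
    by (intro sum.cong refl) (simp add: Cons sum_distrib_left mult_ac)
  also have "\<dots> = (\<Sum>j\<in>{1..n}. v j * (\<Sum>l\<in>{1..n}. weight i l * act w (simple_root j) l))"
    by (subst sum.swap) (simp add: sum_distrib_left)
  finally show ?case
    by (simp add: reflect_def Cons sum_subtractf right_diff_distrib)
qed

section \<open>Dihedral relations on vectors\<close>

lemma sum_two:
  fixes f :: "nat \<Rightarrow> real"
  assumes "i \<in> {1..n}" "j \<in> {1..n}" "i \<noteq> j"
  shows "(\<Sum>l\<in>{1..n}. f l) = f i + f j + (\<Sum>l\<in>{1..n} - {i, j}. f l)"
  using assms sum.subset_diff[of "{i, j}" "{1..n}" f] by simp

definition in_plane :: "nat \<Rightarrow> nat \<Rightarrow> real \<Rightarrow> real \<Rightarrow> nat \<Rightarrow> real" where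
  "in_plane i j x y = (\<lambda>l. if l = i then x else if l = j then y else 0)"

lemma in_plane_swap: "i \<noteq> j \<Longrightarrow> in_plane i j x y = in_plane j i y x"
  by (auto simp: in_plane_def)

lemma reflect_in_plane:
  assumes "i \<in> {1..n}" "j \<in> {1..n}" "i \<noteq> j"
  shows "reflect i (in_plane i j x y) = in_plane i j (weight i j * y - x) y"
proof -
  have "(\<Sum>l\<in>{1..n} - {i, j}. weight i l * in_plane i j x y l) = 0"
    by (rule sum.neutral) (simp add: in_plane_def)
  then show ?thesis
    using assms sum_two[OF assms, of "\<lambda>l. weight i l * in_plane i j x y l"]
    by (auto simp: reflect_def in_plane_def)
qed

text \<open>The product of the two reflections rotates the plane by the angle \<open>2 * t\<close>;
  the sine quotients are the entries of its powers in the basis of the two roots. Each step is the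
  recurrence \<open>sin (a + t) = 2 * cos t * sin a - sin (a - t)\<close>.\<close>

lemma dihedral_rotation:
  assumes "i \<in> {1..n}" "j \<in> {1..n}" "i \<noteq> j" "weight i j = 2 * cos t" "sin t \<noteq> 0"
  shows "act (alt i j (2 * k)) (in_plane i j x y) = in_plane i j
    ((x * sin ((2 * real k + 1) * t) - y * sin (2 * real k * t)) / sin t)
    ((x * sin (2 * real k * t) - y * sin ((2 * real k - 1) * t)) / sin t)"
proof (induction k)
  case 0
  show ?case using assms(5) by simp
next
  case (Suc k)
  have rec: "sin (a + t) = 2 * cos t * sin a - sin (a - t)" for a
    by (simp add: sin_add sin_diff)
  have s: "sin ((2 * real (Suc k) + 1) * t) = 2 * cos t * sin (2 * real (Suc k) * t) - sin ((2 * real k + 1) * t)"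
    using rec[of "2 * real (Suc k) * t"] by (simp add: algebra_simps)
  have s': "sin (2 * real (Suc k) * t) = 2 * cos t * sin ((2 * real k + 1) * t) - sin (2 * real k * t)"
    using rec[of "(2 * real k + 1) * t"] by (simp add: algebra_simps)
  have s'': "sin ((2 * real k + 1) * t) = 2 * cos t * sin (2 * real k * t) - sin ((2 * real k - 1) * t)"
    using rec[of "2 * real k * t"] by (simp add: algebra_simps)
  have e: "(2 * real (Suc k) - 1) * t = (2 * real k + 1) * t" by simp
  have step: "act (alt i j (2 * Suc k)) v = reflect i (reflect j (act (alt i j (2 * k)) v))" for v
    by simp
  have reflect_j: "reflect j (in_plane i j a b) = in_plane i j a (2 * cos t * a - b)" for a b
    using reflect_in_plane[of j i b a] assms(1-4) weight_sym[OF assms(1,2)]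
    by (simp add: in_plane_swap[of i j])
  define B where "B = sin (2 * real k * t)"
  define C where "C = sin ((2 * real k - 1) * t)"
  define A where "A = 2 * cos t * B - C"
  have A: "sin ((2 * real k + 1) * t) = A" using s'' unfolding A_def B_def C_def .
  have second: "2 * cos t * ((x * A - y * B) / sin t) - (x * B - y * C) / sin t
      = (x * (2 * cos t * A - B) - y * A) / sin t"
    by (simp add: A_def algebra_simps diff_divide_distrib add_divide_distrib)
  show ?case
    unfolding step Suc reflect_j reflect_in_plane[OF assms(1-3)] assms(4) s e s' A
    unfolding B_def[symmetric] C_def[symmetric]
    unfolding second
    by (intro arg_cong2[where f = "in_plane i j"])
      (simp_all add: algebra_simps diff_divide_distrib add_divide_distrib)
qed

text \<open>With \<open>t = pi / k\<close>, the \<open>k\<close>-th power of the rotation is a full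
  turn, hence trivial on the plane; a general vector is reduced to this case.\<close>

lemma act_dihedral:
  assumes "i \<in> {1..n}" "j \<in> {1..n}" "i \<noteq> j" "m i j = enat k"
  shows "act (alt i j (2 * k)) v = v"
proof -
  define t where "t = pi / k"
  have k: "2 \<le> k" using matrix_ge2[OF assms(1-3)] assms(4) by (simp add: numeral_eq_enat)
  then have "0 < t" "t < pi" unfolding t_def by (auto simp: field_simps)
  then have sin: "0 < sin t" by (rule sin_gt_zero)
  have w: "weight i j = 2 * cos t" "weight j i = 2 * cos t"
    using assms weight_sym[OF assms(1,2)] by (simp_all add: weight_def t_def)
  have kt: "2 * real k * t = 2 * pi" using k by (simp add: t_def)
  then have "(2 * real k + 1) * t = t + 2 * pi" "(2 * real k - 1) * t = - t + 2 * pi"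
    by (simp_all add: algebra_simps)
  then have s: "sin ((2 * real k + 1) * t) = sin t" "sin ((2 * real k - 1) * t) = - sin t"
    "sin (2 * real k * t) = 0"
    using sin_periodic[of t] sin_periodic[of "- t"] kt by (simp_all only: sin_minus sin_two_pi)
  have plane: "act (alt i j (2 * k)) (in_plane i j x y) = in_plane i j x y" for x y
    using dihedral_rotation[OF assms(1-3) w(1), of k x y] sin unfolding s by simp
  \<comment> \<open>For finite \<open>m i j\<close> the form is nondegenerate on the plane of the two roots, so \<open>v\<close> splits
    into a vector \<open>u\<close> fixed by both reflections and one in that plane.\<close>
  define p where "p = (\<Sum>l\<in>{1..n} - {i, j}. weight i l * v l)"
  define q where "q = (\<Sum>l\<in>{1..n} - {i, j}. weight j l * v l)"
  \<comment> \<open>Cramer's rule with determinant \<open>d\<close> for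
    \<open>2 * x - 2 * cos t * y = p\<close> and \<open>2 * y - 2 * cos t * x = q\<close>, which say
    that both reflections fix \<open>v\<close> once its coordinates \<open>i\<close> and
    \<open>j\<close> are replaced by \<open>x\<close> and \<open>y\<close>.\<close>
  define d where "d = 4 - (2 * cos t)\<^sup>2"
  have "d = 4 * (sin t)\<^sup>2" using sin_cos_squared_add[of t] by (simp add: d_def power2_eq_square)
  then have d: "d \<noteq> 0" using sin by simp
  define x where "x = (2 * p + 2 * cos t * q) / d"
  define y where "y = (2 * q + 2 * cos t * p) / d"
  have fix_eq: "2 * cos t * y + p = 2 * x" "2 * cos t * x + q = 2 * y"
  proof -
    have "d * x = 2 * p + 2 * cos t * q" "d * y = 2 * q + 2 * cos t * p"
      using d by (simp_all add: x_def y_def)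
    then have "d * (2 * cos t * y + p - 2 * x) = 0" "d * (2 * cos t * x + q - 2 * y) = 0"
      unfolding d_def by algebra+
    then show "2 * cos t * y + p = 2 * x" "2 * cos t * x + q = 2 * y" using d by simp_all
  qed
  define u where "u = v(i := x, j := y)"
  have out: "(\<Sum>l\<in>{1..n} - {i, j}. weight a l * u l) = (\<Sum>l\<in>{1..n} - {i, j}. weight a l * v l)" for a
    by (rule sum.cong) (auto simp: u_def)
  have "(\<Sum>l\<in>{1..n}. weight i l * u l) = 2 * u i" "(\<Sum>l\<in>{1..n}. weight j l * u l) = 2 * u j"
    unfolding sum_two[OF assms(1-3)] out p_def[symmetric] q_def[symmetric]
    using fix_eq assms(3) w by (simp_all add: u_def)
  then have "reflect i u = u" "reflect j u = u"
    by (simp_all only: reflect_def mult_2 add_diff_cancel_right' fun_upd_triv)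
  then have "act (alt i j l) u = u \<and> act (alt j i l) u = u" for l
    by (induction l) auto
  moreover have "v = (\<lambda>l. 1 * u l + 1 * in_plane i j (v i - x) (v j - y) l)"
    using assms(3) by (auto simp: u_def in_plane_def)
  ultimately show ?thesis
    using act_linear[of "alt i j (2 * k)" 1 u 1 "in_plane i j (v i - x) (v j - y)"]
    by (simp add: plane)
qed

lemma act_weq: "u \<approx> v \<Longrightarrow> act u = act v"
proof (rule weq_invariant)
  fix u v assume "cstep n m u v"
  then obtain a b r where r: "relator n m r" "u = a @ r @ b" "v = a @ b"
    unfolding cstep_def by blast
  have "act r w = w" for w
    using r(1) unfolding relator_def by (auto simp: act_dihedral reflect_reflect)
  then show "act u = act v" using r(2,3) by (intro ext) (simp add: act_append)
qed

section \<open>Lengths and signs of roots\<close>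

text \<open>Chebyshev polynomials of the second kind with shifted index,
  \<open>U\<^sub>k\<^sub>-\<^sub>1(c / 2)\<close>: the root coefficients in a dihedral
  group.\<close>

fun chebyshev :: "real \<Rightarrow> nat \<Rightarrow> real" where
  "chebyshev c 0 = 0"
| "chebyshev c (Suc 0) = 1"
| "chebyshev c (Suc (Suc k)) = c * chebyshev c (Suc k) - chebyshev c k"

lemma chebyshev_sin: "chebyshev (2 * cos t) k * sin t = sin (k * t)"
proof (induction "2 * cos t" k rule: chebyshev.induct)
  case (3 k)
  have "sin (real (Suc (Suc k)) * t) = sin (real (Suc k) * t + t)"
    by (simp add: algebra_simps)
  moreover have "sin (real k * t) = sin (real (Suc k) * t - t)"
    by (simp add: algebra_simps)
  ultimately have "sin (real (Suc (Suc k)) * t) = 2 * cos t * sin (real (Suc k) * t) - sin (real k * t)"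
    unfolding sin_add sin_diff by simp
  then show ?case using 3 by (simp only: chebyshev.simps left_diff_distrib mult.assoc)
qed simp_all

lemma chebyshev_two: "chebyshev 2 k = k"
  by (induction "2 :: real" k rule: chebyshev.induct) simp_all

text \<open>For finite \<open>m i j = p\<close> the value is
  \<open>sin (k * pi / p) / sin (pi / p)\<close> with \<open>k * pi / p\<close> at most
  \<open>pi\<close>; for infinite \<open>m i j\<close> the weight is 2 and the value is
  \<open>k\<close>.\<close>

lemma chebyshev_weight_nonneg:
  assumes "i \<in> {1..n}" "j \<in> {1..n}" "i \<noteq> j" "enat k \<le> m i j"
  shows "0 \<le> chebyshev (weight i j) k"
proof (cases "m i j")
  case (enat p)
  define t where "t = pi / p"
  have p: "2 \<le> p" using matrix_ge2[OF assms(1-3)] enat by (simp add: numeral_eq_enat)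
  then have "0 < t" "t < pi" unfolding t_def by (auto simp: field_simps)
  then have "0 < sin t" by (rule sin_gt_zero)
  moreover have "k \<le> p" using assms(4) enat by simp
  then have "k * t \<le> pi" using p by (simp add: t_def field_simps)
  then have "0 \<le> sin (k * t)" using \<open>0 < t\<close> by (intro sin_ge_zero) auto
  then have "0 \<le> chebyshev (2 * cos t) k * sin t" by (simp add: chebyshev_sin)
  ultimately show ?thesis using assms(3) enat by (simp add: weight_def t_def zero_le_mult_iff)
qed (use assms(3) in \<open>simp add: weight_def chebyshev_two\<close>)

text \<open>Naming the first letter \<open>i\<close> instead of the last lets the induction strip
  letters from the left; which of the two letters \<open>s\<close> is need not be tracked.\<close>

lemma act_alt_simple_root:
  assumes "i \<in> {1..n}" "j \<in> {1..n}" "i \<noteq> j" "u @ [s] = alt i j (Suc k)"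
  shows "act u (simple_root s) =
    in_plane i j (chebyshev (weight i j) (Suc k)) (chebyshev (weight i j) k)"
  using assms
proof (induction k arbitrary: i j u)
  case 0
  then show ?case by (auto simp: in_plane_def simple_root_def)
next
  case (Suc k)
  from Suc.prems(4) obtain u' where u: "u = i # u'" "u' @ [s] = alt j i (Suc k)"
    by (cases u) auto
  have "act u' (simple_root s) =
      in_plane i j (chebyshev (weight i j) k) (chebyshev (weight i j) (Suc k))"
    using Suc.IH[OF _ _ _ u(2)] Suc.prems in_plane_swap[of i j] weight_sym[of i j] by metis
  then show ?case using Suc.prems u(1) by (simp add: reflect_in_plane)
qed

text \<open>Split \<open>w = v u\<close> with \<open>u\<close> in the dihedral parabolic of \<open>s\<close> and the last letter of \<open>w\<close>, and \<open>v\<close> as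
  short as possible: then \<open>v\<close> sends both roots of the plane to nonnegative vectors by induction.\<close>

lemma root_nonneg:
  assumes "red (w @ [s])" "s \<in> {1..n}" "set w \<subseteq> {1..n}"
  shows "0 \<le> act w (simple_root s) k"
  using assms
proof (induction "length w" arbitrary: w s k rule: less_induct)
  case less
  show ?case
  proof (cases w rule: rev_cases)
    case Nil
    then show ?thesis by (simp add: simple_root_def)
  next
    case (snoc w0 t)
    have t: "t \<in> {1..n}" "t \<noteq> s"
      using less.prems red_no_repeat[of s w0 "[]"] snoc by auto
    define P where "P v \<longleftrightarrow> (\<exists>u. set u \<subseteq> {s, t} \<and> v @ u \<approx> w \<and> length v + length u = length w)" for v
    have "P w0" unfolding P_def by (rule exI[of _ "[t]"]) (simp add: snoc)
    then obtain v where v: "P v" "\<And>v'. P v' \<Longrightarrow> length v \<le> length v'"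
      using ex_has_least_nat[of P w0 length] by blast
    then obtain u where u: "set u \<subseteq> {s, t}" "v @ u \<approx> w" "length v + length u = length w"
      unfolding P_def by blast
    have short: "length v < length w" using v(2)[OF \<open>P w0\<close>] snoc by simp
    have vset: "set v \<subseteq> {1..n}" using weq_set[OF u(2)] less.prems(3) by (simp only: set_append) blast
    have "red w" using less.prems(1) by (rule red_prefix)
    then have "red (v @ u)" using red_weq[OF _ weq_sym[OF u(2)]] u(3) by simp
    then have redv: "red v" by (rule red_prefix)
    have pos: "0 \<le> act v (simple_root r) l" if r: "r \<in> {s, t}" for r l
    proof -
      have rn: "r \<in> {1..n}" using r t less.prems(2) by blast
      \<comment> \<open>If \<open>r\<close> shortened \<open>v\<close>, it could be moved from the
        end of \<open>v\<close> to the front of \<open>u\<close>, against the minimality of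
        \<open>v\<close>.\<close>
      have "red (v @ [r])"
      proof (rule ccontr)
        assume "\<not> red (v @ [r])"
        from not_red_snoc[OF redv this rn] obtain v' where
          v': "v' @ [r] \<approx> v" "length v = Suc (length v')" by blast
        have "v' @ r # u \<approx> v @ u" using weq_append[OF v'(1) weq_refl, of u] by simp
        then have "P v'"
          unfolding P_def using u r v'(2) by (intro exI[of _ "r # u"]) (auto intro: weq_trans)
        then show False using v(2) v'(2) by fastforce
      qed
      then show ?thesis using less.hyps[OF short _ rn vset] by blast
    qed
    have "red (v @ u @ [s])"
      using red_weq[OF less.prems(1), of "v @ u @ [s]"] weq_append[OF weq_sym[OF u(2)] weq_refl, of "[s]"] u(3)
      by simp
    then have redu: "red (u @ [s])" by (rule red_suffix)
    have "set (u @ [s]) \<subseteq> {s, t}" using u(1) by simp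
    then obtain x y where xy: "u @ [s] = alt x y (Suc (length u))" "{x, y} = {s, t}"
      using red_two_letters_alt[OF redu _ less.prems(2) t(1)] t(2)
      by (metis insert_commute length_append_singleton)
    have xyn: "x \<in> {1..n}" "y \<in> {1..n}" "x \<noteq> y"
      using xy(2) t less.prems(2) by (auto simp: doubleton_eq_iff)
    \<comment> \<open>A reduced alternating word has at most \<open>m x y\<close> letters, which
      keeps both Chebyshev coefficients nonnegative.\<close>
    have bound: "enat (Suc (length u)) \<le> m x y"
    proof (cases "m x y")
      case (enat p)
      then show ?thesis using not_red_alt[OF xyn enat, of "Suc (length u)"] redu xy(1) by force
    qed simp
    then have bound': "enat (length u) \<le> m x y" by (meson enat_ord_simps(1) le_SucI order_refl order_trans)
    define a where "a = chebyshev (weight x y) (Suc (length u))"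
    define b where "b = chebyshev (weight x y) (length u)"
    have ab: "0 \<le> a" "0 \<le> b"
      unfolding a_def b_def using chebyshev_weight_nonneg[OF xyn] bound bound' by blast+
    have "act u (simple_root s) = (\<lambda>l. a * simple_root x l + b * simple_root y l)"
      unfolding act_alt_simple_root[OF xyn xy(1)] a_def[symmetric] b_def[symmetric]
      using xyn(3) by (auto simp: in_plane_def simple_root_def)
    then have "act w (simple_root s) = (\<lambda>l. a * act v (simple_root x) l + b * act v (simple_root y) l)"
      using act_weq[OF u(2)] by (simp add: act_append act_linear flip: act_weq[OF u(2)])
    moreover have "x \<in> {s, t}" "y \<in> {s, t}" using xy(2) by blast+
    ultimately show ?thesis using pos ab by simp
  qed
qed

text \<open>A reduced word for \<open>w\<close> can be chosen to end in \<open>s\<close>, and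
  \<open>s\<close> negates its own root.\<close>

lemma root_nonpos:
  assumes "red w" "\<not> red (w @ [s])" "s \<in> {1..n}" "set w \<subseteq> {1..n}"
  shows "act w (simple_root s) k \<le> 0"
proof -
  obtain v where v: "v @ [s] \<approx> w" "red (v @ [s])"
    using not_red_snoc[OF assms(1-3)] by blast
  have "set v \<subseteq> {1..n}" using weq_set[OF v(1)] assms(4) by (simp only: set_append) blast
  then have "0 \<le> act v (simple_root s) k" using root_nonneg v(2) assms(3) by blast
  then show ?thesis using act_weq[OF v(1)] act_snoc_simple_root[of v s] by (simp flip: act_weq[OF v(1)])
qed

text \<open>Otherwise the image of the root would have both signs and vanish, but the action is
  invertible.\<close>

lemma not_red_if_root_nonpos:
  assumes "s \<in> {1..n}" "set w \<subseteq> {1..n}" "\<forall>k. act w (simple_root s) k \<le> 0"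
  shows "\<not> red (w @ [s])"
proof
  assume "red (w @ [s])"
  then have "act w (simple_root s) k = 0" for k
    using root_nonneg[OF _ assms(1,2), of k] assms(3) by (simp add: order_antisym)
  then have "act w (simple_root s) = (\<lambda>k. 0 * act w (simple_root s) k)" by auto
  then have "act (rev w) (act w (simple_root s)) = (\<lambda>k. 0)" using act_scale[of "rev w" 0] by auto
  then have "simple_root s s = 0" unfolding act_rev by (rule fun_cong)
  then show False by (simp add: simple_root_def)
qed

section \<open>Longest elements and finiteness\<close>

lemma act_other: "j \<notin> set w \<Longrightarrow> act w v j = v j"
  by (induction w) (auto simp: reflect_def)

text \<open>Every further letter of \<open>v\<close> shortens the element of \<open>w @ v\<close>:
  the root of \<open>s\<close> goes under \<open>v\<close> to a nonnegative combination of simple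
  roots, each of which \<open>w\<close> makes nonpositive. So a word of length
  \<open>length w - length v\<close> exists.\<close>

lemma red_length_le_longest:
  assumes w: "red w" "set w \<subseteq> {1..n}" "\<forall>j\<in>{1..n}. \<not> red (w @ [j])"
    and "red v" "set v \<subseteq> {1..n}"
  shows "length v \<le> length w"
proof -
  have "\<exists>u. u \<approx> w @ v \<and> length u + length v = length w \<and> red u"
    using assms(4,5)
  proof (induction v rule: rev_induct)
    case Nil
    then show ?case using w(1) by (intro exI[of _ w]) simp
  next
    case (snoc s v)
    have s: "s \<in> {1..n}" and v: "set v \<subseteq> {1..n}" using snoc.prems(2) by auto
    have "red v" using snoc.prems(1) by (rule red_prefix)
    then obtain u where u: "u \<approx> w @ v" "length u + length v = length w" "red u"
      using snoc.IH v by blast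
    have uset: "set u \<subseteq> {1..n}" using weq_set[OF u(1)] w(2) v by (simp only: set_append) blast
    have "act u (simple_root s) k \<le> 0" for k
    proof -
      have "act v (simple_root s) j = 0" if "j \<notin> {1..n}" for j
      proof -
        have "j \<notin> set v" "j \<noteq> s" using that v s by blast+
        then show ?thesis by (simp add: act_other simple_root_def)
      qed
      then have "act w (act v (simple_root s)) k
          = (\<Sum>j\<in>{1..n}. act v (simple_root s) j * act w (simple_root j) k)"
        by (intro act_expand) blast
      also have "\<dots> \<le> 0"
      proof (rule sum_nonpos)
        fix j assume j: "j \<in> {1..n}"
        show "act v (simple_root s) j * act w (simple_root j) k \<le> 0"
          using root_nonneg[OF snoc.prems(1) s v, of j] root_nonpos[OF w(1) _ j w(2), of k] w(3) j
          by (intro mult_nonneg_nonpos) auto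
      qed
      finally show ?thesis by (simp add: act_weq[OF u(1)] act_append)
    qed
    then have "\<not> red (u @ [s])" using not_red_if_root_nonpos[OF s uset] by blast
    from not_red_snoc[OF u(3) this s] obtain u' where
      u': "u' \<approx> u @ [s]" "length u = Suc (length u')" "red (u' @ [s])" by blast
    have "u @ [s] \<approx> w @ v @ [s]" using weq_append[OF u(1) weq_refl, of "[s]"] by simp
    then show ?case using u' u(2) red_prefix by (intro exI[of _ u']) (auto intro: weq_trans)
  qed
  then show ?thesis by auto
qed

lemma not_infinite_if_longest:
  assumes "red w" "set w \<subseteq> {1..n}" "\<forall>j\<in>{1..n}. \<not> red (w @ [j])"
  shows "\<not> coxeter_infinite n m"
proof -
  have "(\<lambda>u. {v. u \<approx> v}) ` {u. is_word n u}
      \<subseteq> (\<lambda>u. {v. u \<approx> v}) ` {u. set u \<subseteq> {1..n} \<and> length u \<le> length w}" (is "?L \<subseteq> ?R")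
  proof
    fix X assume "X \<in> ?L"
    then obtain u where u: "X = {v. u \<approx> v}" "set u \<subseteq> {1..n}" by (auto simp only: is_word_def)
    obtain u' where u': "u \<approx> u'" "red u'" using ex_red by blast
    have "set u' \<subseteq> {1..n}" using weq_set[OF u'(1)] u(2) by blast
    moreover have "length u' \<le> length w" using red_length_le_longest[OF assms u'(2)] calculation .
    moreover have "X = {v. u' \<approx> v}" using u(1) u'(1) weq_sym weq_trans by blast
    ultimately show "X \<in> ?R" by blast
  qed
  moreover have "finite ?R" by (intro finite_imageI finite_lists_length_le) simp
  ultimately show ?thesis unfolding coxeter_infinite_def using finite_subset by blast
qed

section \<open>Orientations and the skew form\<close>

text \<open>A height function \<open>h\<close> orients every edge from its lower to its higher end, so that, for
  adjacent \<open>i\<close> and \<open>j\<close>, \<open>i\<close> precedes \<open>j\<close> in the Coxeter element iff \<open>h i < h j\<close>.  Raising a source by \<open>n\<close> reverses its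
  edges as long as \<open>h\<close> is balanced.\<close>

definition source :: "(nat \<Rightarrow> nat) \<Rightarrow> nat \<Rightarrow> bool" where
  "source h x \<longleftrightarrow> x \<in> {1..n} \<and> (\<forall>y. edge x y \<longrightarrow> h x < h y)"

definition flip :: "(nat \<Rightarrow> nat) \<Rightarrow> nat \<Rightarrow> nat \<Rightarrow> nat" where
  "flip h x = h(x := h x + n)"

text \<open>As \<open>edge\<close> is symmetric, neighbouring heights differ by less than
  \<open>n\<close>, so a source raised by \<open>n\<close> lands strictly above all its
  neighbours.\<close>

definition balanced :: "(nat \<Rightarrow> nat) \<Rightarrow> bool" where
  "balanced h \<longleftrightarrow> (\<forall>i j. edge i j \<longrightarrow> h i \<noteq> h j \<and> h i < h j + n)"

fun source_seq :: "(nat \<Rightarrow> nat) \<Rightarrow> nat list \<Rightarrow> bool" where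
  "source_seq h [] = True"
| "source_seq h (x # xs) = (source h x \<and> source_seq (flip h x) xs)"

abbreviation final :: "(nat \<Rightarrow> nat) \<Rightarrow> nat list \<Rightarrow> nat \<Rightarrow> nat" where
  "final \<equiv> foldl flip"

lemma balanced_flip:
  assumes "balanced h" "source h x"
  shows "balanced (flip h x)"
  unfolding balanced_def
proof (intro allI impI)
  fix i j assume e: "edge i j"
  then have "i \<noteq> j" by (simp add: dynkin_edge_def)
  moreover have "h i \<noteq> h j" "h i < h j + n" "h j < h i + n"
    using assms(1) e edge_sym[OF e] unfolding balanced_def by blast+
  moreover have "i = x \<Longrightarrow> h x < h j" "j = x \<Longrightarrow> h x < h i"
    using assms(2) e edge_sym[OF e] unfolding source_def by blast+
  ultimately show "flip h x i \<noteq> flip h x j \<and> flip h x i < flip h x j + n"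
    by (auto simp: flip_def)
qed

lemma source_seq_append:
  "source_seq h (xs @ ys) \<longleftrightarrow> source_seq h xs \<and> source_seq (final h xs) ys"
  by (induction xs arbitrary: h) auto

lemma balanced_final: "balanced h \<Longrightarrow> source_seq h xs \<Longrightarrow> balanced (final h xs)"
  by (induction xs arbitrary: h) (auto simp: balanced_flip)

lemma source_seq_set: "source_seq h xs \<Longrightarrow> set xs \<subseteq> {1..n}"
  by (induction xs arbitrary: h) (auto simp: source_def)

text \<open>The sign is positive from the lower to the higher end of an edge. Heights of distinct
  non-adjacent generators do not matter, since their weight vanishes.\<close>

definition skew :: "(nat \<Rightarrow> nat) \<Rightarrow> nat \<Rightarrow> nat \<Rightarrow> real" where
  "skew h i j = weight i j * sgn (real (h j) - real (h i))"

definition skew_form :: "(nat \<Rightarrow> nat) \<Rightarrow> (nat \<Rightarrow> real) \<Rightarrow> (nat \<Rightarrow> real) \<Rightarrow> real" where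
  "skew_form h v w = (\<Sum>i\<in>{1..n}. \<Sum>j\<in>{1..n}. skew h i j * v i * w j)"

lemma skew_source:
  assumes "source h x" "j \<in> {1..n}"
  shows "skew h x j = weight x j" "skew h j x = - weight x j"
proof -
  have x: "x \<in> {1..n}" using assms(1) by (simp add: source_def)
  show "skew h x j = weight x j" "skew h j x = - weight x j"
    using assms weight_zero[OF x assms(2)] weight_sym[OF x assms(2)]
    by (cases "edge x j"; force simp: skew_def source_def)+
qed

lemma skew_flip_source:
  assumes "balanced h" "source h x" "j \<in> {1..n}"
  shows "skew (flip h x) x j = - weight x j" "skew (flip h x) j x = weight x j"
proof -
  have x: "x \<in> {1..n}" using assms(2) by (simp add: source_def)
  have "h j < h x + n \<and> j \<noteq> x" if "edge x j"
    using assms(1) edge_sym[OF that] unfolding balanced_def by (auto simp: dynkin_edge_def)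
  then show "skew (flip h x) x j = - weight x j" "skew (flip h x) j x = weight x j"
    using weight_zero[OF x assms(3)] weight_sym[OF x assms(3)]
    by (cases "edge x j"; force simp: skew_def flip_def)+
qed

lemma skew_flip_other: "i \<noteq> x \<Longrightarrow> j \<noteq> x \<Longrightarrow> skew (flip h x) i j = skew h i j"
  by (simp add: skew_def flip_def)

lemma skew_form_split:
  assumes "x \<in> {1..n}"
  shows "skew_form h v w = v x * (\<Sum>j\<in>{1..n}-{x}. skew h x j * w j)
    + (\<Sum>i\<in>{1..n}-{x}. skew h i x * v i) * w x
    + (\<Sum>i\<in>{1..n}-{x}. \<Sum>j\<in>{1..n}-{x}. skew h i j * v i * w j)"
proof -
  have rem: "(\<Sum>i\<in>{1..n}. f i) = f x + (\<Sum>i\<in>{1..n}-{x}. f i)" for f :: "nat \<Rightarrow> real"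
    using assms by (simp add: sum.remove)
  show ?thesis
    unfolding skew_form_def rem sum.distrib
    by (simp add: skew_def sum_distrib_left sum_distrib_right mult_ac)
qed

text \<open>Only coordinate \<open>x\<close> changes, from \<open>u x\<close> to
  \<open>S u - u x\<close>. At a source the two products \<open>S v * S w\<close> cancel, and what
  remains is the form with the signs at \<open>x\<close> reversed.\<close>

lemma skew_form_reflect:
  assumes "balanced h" "source h x"
  shows "skew_form h (reflect x v) (reflect x w) = skew_form (flip h x) v w"
proof -
  have x: "x \<in> {1..n}" using assms(2) by (simp add: source_def)
  define S where "S u = (\<Sum>j\<in>{1..n}-{x}. weight x j * u j)" for u
  define R where "R = (\<Sum>i\<in>{1..n}-{x}. \<Sum>j\<in>{1..n}-{x}. skew h i j * v i * w j)"
  have other: "reflect x u j = u j" if "j \<noteq> x" for u j using that by (simp add: reflect_def)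
  have diag: "reflect x u x = S u - u x" for u
    using x by (simp add: reflect_def S_def sum.remove)
  have "skew_form h (reflect x v) (reflect x w) =
      reflect x v x * (\<Sum>j\<in>{1..n}-{x}. weight x j * w j)
      + (\<Sum>i\<in>{1..n}-{x}. - (weight x i * v i)) * reflect x w x + R"
    unfolding skew_form_split[OF x, of h] R_def
    by (intro arg_cong2[where f = "(+)"] arg_cong2[where f = "(*)"] refl sum.cong)
      (use skew_source[OF assms(2)] other in simp_all)
  then have "skew_form h (reflect x v) (reflect x w) = (S v - v x) * S w - S v * (S w - w x) + R"
    by (simp only: diag S_def[symmetric] sum_negf mult_minus_left add_uminus_conv_diff)
  moreover have "skew_form (flip h x) v w =
      v x * (\<Sum>j\<in>{1..n}-{x}. - (weight x j * w j))
      + (\<Sum>i\<in>{1..n}-{x}. weight x i * v i) * w x + R"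
    unfolding skew_form_split[OF x, of "flip h x"] R_def
    by (intro arg_cong2[where f = "(+)"] arg_cong2[where f = "(*)"] refl sum.cong)
      (use skew_flip_source[OF assms] skew_flip_other[of _ x _ h] in simp_all)
  then have "skew_form (flip h x) v w = - v x * S w + S v * w x + R"
    by (simp only: S_def[symmetric] sum_negf mult_minus_right mult_minus_left)
  ultimately show ?thesis by (simp add: algebra_simps)
qed

lemma skew_form_act:
  "balanced h \<Longrightarrow> source_seq h xs \<Longrightarrow>
    skew_form h (act xs v) (act xs w) = skew_form (final h xs) v w"
  by (induction xs arbitrary: h) (simp_all add: skew_form_reflect balanced_flip)

lemma skew_form_simple_root_left:
  assumes "l \<in> {1..n}"
  shows "skew_form h (simple_root l) w = (\<Sum>j\<in>{1..n}. skew h l j * w j)"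
proof -
  have "skew_form h (simple_root l) w =
      (\<Sum>i\<in>{1..n}. if i = l then \<Sum>j\<in>{1..n}. skew h l j * w j else 0)"
    unfolding skew_form_def by (intro sum.cong) (auto simp: simple_root_def)
  then show ?thesis using assms by simp
qed

lemma skew_form_simple_roots:
  assumes "l \<in> {1..n}" "j \<in> {1..n}"
  shows "skew_form h (simple_root l) (simple_root j) = skew h l j"
proof -
  have "skew_form h (simple_root l) (simple_root j) = (\<Sum>i\<in>{1..n}. if i = j then skew h l j else 0)"
    unfolding skew_form_simple_root_left[OF assms(1)]
    by (intro sum.cong) (auto simp: simple_root_def)
  then show ?thesis using assms by simp
qed

lemma skew_form_source_nonneg:
  assumes "source h x" "\<forall>k. 0 \<le> v k"
  shows "0 \<le> skew_form h (simple_root x) v"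
proof -
  have x: "x \<in> {1..n}" using assms(1) by (simp add: source_def)
  show ?thesis
    unfolding skew_form_simple_root_left[OF x]
    using skew_source(1)[OF assms(1)] weight_nonneg[OF x] assms(2)
    by (intro sum_nonneg) simp
qed

lemma skew_form_scale_left: "skew_form h (\<lambda>k. c * v k) w = c * skew_form h v w"
  by (simp add: skew_form_def sum_distrib_left mult_ac)

section \<open>Descents of source sequences\<close>

text \<open>If \<open>j\<close> were not a descent, induction would make \<open>l\<close> a
  non-descent of \<open>xs\<close>, so the letter \<open>x\<close> alone turns its root negative and
  the image is \<open>- t\<close> times the root of \<open>x\<close>. As \<open>x\<close> is a
  source, this pairs nonpositively with the nonnegative image of the root of \<open>j\<close>;
  carried to the final orientation the pairing is the positive weight of the edge.\<close>

lemma not_red_upward: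
  assumes "source_seq h xs" "balanced h" "red xs" "edge l j" "final h xs l < final h xs j"
    and "\<not> red (xs @ [l])"
  shows "\<not> red (xs @ [j])"
  using assms
proof (induction xs arbitrary: h)
  case Nil
  then show ?case using red_singleton by simp
next
  case (Cons x xs)
  let ?h = "flip h x"
  have x: "source h x" "x \<in> {1..n}" and xs: "source_seq ?h xs"
    using Cons.prems(1) by (auto simp: source_def)
  have bal: "balanced ?h" using balanced_flip Cons.prems(2) x(1) .
  have redxs: "red xs" using red_suffix[of "[x]" xs] Cons.prems(3) by simp
  have lj: "l \<in> {1..n}" "j \<in> {1..n}" using Cons.prems(4) by (auto simp: dynkin_edge_def)
  have set: "set (x # xs) \<subseteq> {1..n}" "set xs \<subseteq> {1..n}"
    using source_seq_set[OF Cons.prems(1)] by auto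
  show ?case
  proof
    assume red: "red ((x # xs) @ [j])"
    then have "red (xs @ [j])" using red_suffix[of "[x]" "xs @ [j]"] by simp
    then have "red (xs @ [l])"
      using Cons.IH[OF xs bal redxs Cons.prems(4)] Cons.prems(5) by auto
    then have pos: "0 \<le> act xs (simple_root l) k" for k
      using root_nonneg lj(1) set(2) by blast
    have neg: "act (x # xs) (simple_root l) k \<le> 0" for k
      using root_nonpos[OF Cons.prems(3,6) lj(1) set(1)] .
    define t where "t = act xs (simple_root l) x"
    \<comment> \<open>The reflection in \<open>x\<close> changes only the coordinate \<open>x\<close>.\<close>
    have "act xs (simple_root l) k = t * simple_root x k" for k
      using pos[of k] neg[of k] by (auto simp: reflect_def simple_root_def t_def)
    then have "act xs (simple_root l) = (\<lambda>k. t * simple_root x k)" by blast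
    then have "act (x # xs) (simple_root l) = (\<lambda>k. - t * simple_root x k)"
      using act_scale[of "[x]" t "simple_root x"] by (simp add: reflect_simple_root)
    then have "skew_form h (act (x # xs) (simple_root l)) (act (x # xs) (simple_root j))
        = - t * skew_form h (simple_root x) (act (x # xs) (simple_root j))"
      by (simp only: skew_form_scale_left)
    moreover have "0 \<le> skew_form h (simple_root x) (act (x # xs) (simple_root j))"
      using skew_form_source_nonneg[OF x(1)] root_nonneg[OF red lj(2) set(1)] by blast
    moreover have "0 \<le> t" using pos by (simp add: t_def)
    ultimately have "skew_form h (act (x # xs) (simple_root l)) (act (x # xs) (simple_root j)) \<le> 0"
      by (simp add: mult_nonneg_nonneg)
    then have "skew (final h (x # xs)) l j \<le> 0"
      unfolding skew_form_act[OF Cons.prems(2,1)] skew_form_simple_roots[OF lj] .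
    then show False using weight_pos[OF Cons.prems(4)] Cons.prems(5) by (simp add: skew_def)
  qed
qed

text \<open>Induction on the final height: a generator that is not a source has a strictly lower
  neighbour, as balancedness excludes ties, and being a descent passes upwards from it.\<close>

lemma all_not_red:
  assumes "source_seq h xs" "balanced h" "red xs"
    and "\<And>x. source (final h xs) x \<Longrightarrow> \<not> red (xs @ [x])"
    and "j \<in> {1..n}"
  shows "\<not> red (xs @ [j])"
  using assms(5)
proof (induction "final h xs j" arbitrary: j rule: less_induct)
  case less
  show ?case
  proof (cases "source (final h xs) j")
    case False
    then obtain l where l: "edge j l" "final h xs l \<le> final h xs j"
      using less.prems by (auto simp: source_def not_less)
    moreover have "final h xs j \<noteq> final h xs l"
      using balanced_final[OF assms(2,1)] l(1) unfolding balanced_def by blast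
    ultimately have lt: "final h xs l < final h xs j" by simp
    have "l \<in> {1..n}" using l(1) by (simp add: dynkin_edge_def)
    then have "\<not> red (xs @ [l])" using less.hyps lt by blast
    then show ?thesis using not_red_upward[OF assms(1-3) edge_sym[OF l(1)] lt] by blast
  qed (use assms(4) in blast)
qed

lemma balanced_bound:
  assumes "balanced h" "(edge ^^ d) l v"
  shows "h v \<le> h l + d * n"
  using assms(2)
proof (induction d arbitrary: v)
  case (Suc d)
  then obtain u where u: "(edge ^^ d) l u" "edge u v" by auto
  then have "h v < h u + n" using assms(1) edge_sym[OF u(2)] unfolding balanced_def by blast
  then show ?case using Suc.IH[OF u(1)] by simp
qed simp

lemma not_infinite_if_not_red:
  assumes irr: "irreducible_cox n m"
    and "source_seq h xs" "balanced h" "red xs"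
    and "source (final h xs) l" "\<not> red (xs @ [l])"
  shows "\<not> coxeter_infinite n m"
proof -
  have l: "l \<in> {1..n}" using assms(5) by (simp add: source_def)
  then have "\<forall>v\<in>{1..n}. \<exists>d. (edge ^^ d) l v"
    using irr unfolding irreducible_cox_def rtranclp_power by blast
  then obtain d where d: "\<And>v. v \<in> {1..n} \<Longrightarrow> (edge ^^ d v) l v" by metis
  \<comment> \<open>As \<open>l\<close> is not flipped, balancedness bounds all heights, and each further flip raises their sum.\<close>
  define M where "M = (\<Sum>v\<in>{1..n}. final h xs l + d v * n)"
  have bound: "(\<Sum>v\<in>{1..n}. final h ys v) \<le> M"
    if "source_seq h ys" "final h ys l = final h xs l" for ys
    unfolding M_def using balanced_bound[OF balanced_final[OF assms(3) that(1)] d] that(2)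
    by (intro sum_mono) fastforce
  \<comment> \<open>The claim is generalised to all \<open>ys\<close> that leave \<open>l\<close> at
    the same height, still a source and a descent, so that sources other than \<open>l\<close> can
    be appended.\<close>
  have "\<not> coxeter_infinite n m"
    if "source_seq h ys" "red ys" "source (final h ys) l" "\<not> red (ys @ [l])"
      "final h ys l = final h xs l" for ys
    using that
  proof (induction "M - (\<Sum>v\<in>{1..n}. final h ys v)" arbitrary: ys rule: less_induct)
    case less
    let ?h = "final h ys"
    show ?case
    proof (cases "\<exists>x. source ?h x \<and> red (ys @ [x])")
      case True
      then obtain x where x: "source ?h x" "red (ys @ [x])" by blast
      have xn: "x \<in> {1..n}" using x(1) by (simp add: source_def)
      have xl: "x \<noteq> l" using x(2) less.prems(4) by blast
      have final: "final h (ys @ [x]) = flip ?h x" by simp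
      have seq: "source_seq h (ys @ [x])" using less.prems(1) x(1) by (simp add: source_seq_append)
      have "(\<Sum>v\<in>{1..n}. flip ?h x v) = ?h x + n + (\<Sum>v\<in>{1..n}-{x}. ?h v)"
        using xn by (simp add: sum.remove flip_def)
      then have "(\<Sum>v\<in>{1..n}. final h (ys @ [x]) v) = (\<Sum>v\<in>{1..n}. ?h v) + n"
        using xn by (simp add: sum.remove)
      moreover have "0 < n" using l by simp
      moreover have fl: "final h (ys @ [x]) l = final h xs l"
        using less.prems(5) xl by (simp add: flip_def)
      \<comment> \<open>Subtraction is truncated; the decrease is strict because the sum for the
        extended word is still at most \<open>M\<close>.\<close>
      ultimately have dec: "M - (\<Sum>v\<in>{1..n}. final h (ys @ [x]) v) < M - (\<Sum>v\<in>{1..n}. ?h v)"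
        using bound[OF seq fl] by simp
      have src: "source (final h (ys @ [x])) l"
        using less.prems(3) xl by (auto simp: source_def flip_def intro: trans_less_add1)
      \<comment> \<open>Two sources are never adjacent, so \<open>x\<close> and \<open>l\<close>
        commute and \<open>l\<close> remains a descent after \<open>x\<close> is appended.\<close>
      have "\<not> edge x l"
      proof
        assume "edge x l"
        then show False
          using x(1) less.prems(3) edge_sym[of x l] unfolding source_def by fastforce
      qed
      then have "[l] @ [x] \<approx> x # [l]"
        by (intro weq_commute) (use xn l xl in auto)
      then have "ys @ ([l] @ [x]) @ [] \<approx> ys @ (x # [l]) @ []" by (rule weq_context)
      then have comm: "(ys @ [x]) @ [l] \<approx> (ys @ [l]) @ [x]" using weq_sym by simp
      have "\<not> red ((ys @ [x]) @ [l])"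
      proof
        assume "red ((ys @ [x]) @ [l])"
        then have "red ((ys @ [l]) @ [x])" using red_weq comm by simp
        then show False using red_prefix less.prems(4) by blast
      qed
      then show ?thesis using less.hyps[OF dec seq x(2) src _ fl] by blast
    next
      case False
      then show ?thesis
        using all_not_red[OF less.prems(1) assms(3) less.prems(2)]
          not_infinite_if_longest[OF less.prems(2) source_seq_set[OF less.prems(1)]] by blast
    qed
  qed
  then show ?thesis using assms by blast
qed

lemma source_seq_red:
  assumes "irreducible_cox n m" "coxeter_infinite n m" "balanced h" "source_seq h xs"
  shows "red xs"
  using assms(4)
proof (induction xs rule: rev_induct)
  case Nil
  show ?case by (simp add: reduced_def)
next
  case (snoc l xs)
  then have "source_seq h xs" "source (final h xs) l" by (simp_all add: source_seq_append)
  then show ?case using snoc.IH not_infinite_if_not_red[OF assms(1) _ assms(3)] assms(2) by blast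
qed

section \<open>From admissible sequences to source sequences\<close>

text \<open>Each reflection overwrites a coordinate that is still zero by a nonnegative combination
  of the others. A positive coordinate \<open>y\<close> lies outside \<open>ws\<close>, so it
  survives and makes its neighbours in \<open>ws\<close> positive.\<close>

lemma act_distinct:
  assumes "distinct ws" "set ws \<subseteq> {1..n}" "\<forall>k. 0 \<le> v k" "\<forall>z\<in>set ws. v z = 0"
  shows "\<forall>k. 0 \<le> act ws v k"
    and "w \<in> set ws \<Longrightarrow> edge w y \<Longrightarrow> 0 < v y \<Longrightarrow> 0 < act ws v w"
proof -
  have "(\<forall>k. 0 \<le> act ws v k) \<and> (\<forall>w\<in>set ws. edge w y \<longrightarrow> 0 < v y \<longrightarrow> 0 < act ws v w)" for y
    using assms
  proof (induction ws)
    case (Cons u ws)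
    then have u: "u \<in> {1..n}" "u \<notin> set ws" "v u = 0" "set ws \<subseteq> {1..n}" by simp_all
    have IH: "\<forall>k. 0 \<le> act ws v k" "\<forall>w\<in>set ws. edge w y \<longrightarrow> 0 < v y \<longrightarrow> 0 < act ws v w"
      using Cons by auto
    have "act ws v u = 0" using act_other u(2,3) by simp
    then have val: "act (u # ws) v k = (if k = u then \<Sum>j\<in>{1..n}. weight u j * act ws v j else act ws v k)" for k
      by (simp add: reflect_def)
    have nn: "0 \<le> weight u j * act ws v j" if "j \<in> {1..n}" for j
      using weight_nonneg[OF u(1) that] IH(1) by simp
    have "0 < (\<Sum>j\<in>{1..n}. weight u j * act ws v j)" if e: "edge u y" "0 < v y"
    proof (rule sum_pos2[of _ y])
      have "y \<notin> set ws" using Cons.prems(4) e(2) by auto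
      then have "act ws v y = v y" by (rule act_other)
      then show "0 < weight u y * act ws v y" using weight_pos[OF e(1)] e(2) by simp
    qed (use e nn in \<open>auto simp: dynkin_edge_def\<close>)
    moreover have "0 \<le> (\<Sum>j\<in>{1..n}. weight u j * act ws v j)" using nn by (rule sum_nonneg)
    ultimately show ?case using IH u(2) unfolding val by auto
  qed simp
  then show "\<forall>k. 0 \<le> act ws v k"
    and "w \<in> set ws \<Longrightarrow> edge w y \<Longrightarrow> 0 < v y \<Longrightarrow> 0 < act ws v w" by blast+
qed

text \<open>The inverse of the Coxeter element is applied to the root of \<open>x\<close> along both
  words. With \<open>x\<close> first, the result is nonpositive; with the neighbour \<open>y\<close>
  before \<open>x\<close>, its coordinate \<open>y\<close> becomes positive in \<open>rev p\<close>
  and is not touched afterwards.\<close>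

lemma initial_not_preceded_by_neighbour:
  assumes "perm_word n (x # ys)" "perm_word n (p @ x # q)" "x # ys \<approx> p @ x # q" "y \<in> set p"
  shows "\<not> edge y x"
proof
  assume e: "edge y x"
  have P: "distinct (x # ys)" "set (x # ys) = {1..n}" "distinct (p @ x # q)" "set (p @ x # q) = {1..n}"
    using assms(1,2) unfolding perm_word_def by blast+
  have sub: "set ys \<subseteq> {1..n}" "set p \<subseteq> {1..n}"
    using equalityD1[OF P(2)] equalityD1[OF P(4)] by simp_all
  define u where "u = act (rev (p @ x # q)) (simple_root x)"
  have "act (x # ys) u = simple_root x"
    using act_rev[of "rev (p @ x # q)" "simple_root x"]
    unfolding u_def act_weq[OF assms(3)] rev_rev_ident .
  then have "u = act (rev (x # ys)) (simple_root x)" using act_rev[of "x # ys" u] by metis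
  also have "\<dots> = (\<lambda>k. - act (rev ys) (simple_root x) k)"
    unfolding rev.simps(2) by (rule act_snoc_simple_root)
  finally have "u y = - act (rev ys) (simple_root x) y" by (rule fun_cong)
  moreover have "\<forall>k. 0 \<le> act (rev ys) (simple_root x) k"
  proof (rule act_distinct(1))
    show "\<forall>z\<in>set (rev ys). simple_root x z = 0" using P(1) by (auto simp: simple_root_def)
  qed (use P(1) sub in \<open>simp_all add: simple_root_def\<close>)
  ultimately have "u y \<le> 0" by simp
  moreover have "y \<notin> set (rev q @ [x])" using P(3) assms(4) by auto
  then have "u y = act (rev p) (simple_root x) y"
    unfolding u_def using act_other[of y "rev q @ [x]" "act (rev p) (simple_root x)"]
    by (simp add: act_append)
  moreover have "0 < act (rev p) (simple_root x) y"
  proof (rule act_distinct(2))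
    show "\<forall>z\<in>set (rev p). simple_root x z = 0" using P(3) by (auto simp: simple_root_def)
  qed (use P(3) sub e assms(4) in \<open>simp_all add: simple_root_def\<close>)
  ultimately show False by simp
qed

text \<open>The word \<open>zs\<close> for the current Coxeter element is kept compatible with the
  heights. No neighbour of \<open>x\<close> lies in \<open>p\<close>, so \<open>x\<close> is a
  source and commutes to the front; conjugation then moves it to the end, giving
  \<open>p @ q @ [x]\<close>, which matches the flipped heights.\<close>

lemma admissible_source_seq:
  assumes "perm_word n zs" "c \<approx> zs" "sorted_wrt (\<lambda>y z. edge y z \<longrightarrow> h y < h z) zs"
    and "balanced h" "admissible n m c xs"
  shows "source_seq h xs"
  using assms
proof (induction xs arbitrary: h c zs)
  case (Cons x xs)
  then obtain ys where ys: "perm_word n (x # ys)" "c \<approx> x # ys"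
    by (auto simp: initial_def)
  then have "x \<in> set zs" using Cons.prems(1) by (auto simp: perm_word_def)
  then obtain p q where zs: "zs = p @ x # q" by (meson split_list)
  have no: "\<not> edge y x" if "y \<in> set p" for y
  proof (rule initial_not_preceded_by_neighbour[OF ys(1) _ _ that])
    show "perm_word n (p @ x # q)" using Cons.prems(1) zs by simp
    show "x # ys \<approx> p @ x # q" using weq_trans[OF weq_sym[OF ys(2)] Cons.prems(2)] zs by simp
  qed
  have P: "distinct (p @ x # q)" "set (p @ x # q) = {1..n}"
    using Cons.prems(1) unfolding zs perm_word_def by simp_all
  then have xn: "x \<in> {1..n}" "set p \<subseteq> {1..n}" by auto
  have src: "source h x"
    unfolding source_def
  proof (intro conjI allI impI)
    fix y assume e: "edge x y"
    then have "y \<in> set (p @ x # q)" "y \<noteq> x" unfolding P(2) by (auto simp: dynkin_edge_def)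
    then have "y \<in> set q" using no edge_sym[OF e] by auto
    then show "h x < h y" using Cons.prems(3) e unfolding zs by (auto simp: sorted_wrt_append)
  qed fact
  have "\<forall>y\<in>set p. \<not> edge x y" using no edge_sym by blast
  then have "p @ [x] \<approx> x # p" using weq_commute xn P(1) by simp
  then have "[x] @ (p @ [x]) @ (q @ [x]) \<approx> [x] @ (x # p) @ (q @ [x])" by (rule weq_context)
  moreover have "[] @ x # x # (p @ q @ [x]) \<approx> [] @ (p @ q @ [x])" by (rule weq_cancel) fact
  moreover have "[x] @ c @ [x] \<approx> [x] @ zs @ [x]" using Cons.prems(2) by (rule weq_context)
  ultimately have "x # c @ [x] \<approx> x # p @ x # q @ [x]" "x # p @ x # q @ [x] \<approx> x # x # p @ q @ [x]"
    "x # x # p @ q @ [x] \<approx> p @ q @ [x]"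
    unfolding zs by simp_all
  then have "x # c @ [x] \<approx> p @ q @ [x]" by (blast intro: weq_trans)
  moreover have "perm_word n (p @ q @ [x])"
    using P unfolding perm_word_def by auto
  moreover have "sorted_wrt (\<lambda>y z. edge y z \<longrightarrow> flip h x y < flip h x z) (p @ q @ [x])"
  proof -
    have "sorted_wrt (\<lambda>y z. edge y z \<longrightarrow> h y < h z) (p @ q)"
      using Cons.prems(3) unfolding zs by (auto simp: sorted_wrt_append)
    then have "sorted_wrt (\<lambda>y z. edge y z \<longrightarrow> flip h x y < flip h x z) (p @ q)"
      by (rule sorted_wrt_mono_rel[rotated]) (use P(1) in \<open>auto simp: flip_def\<close>)
    moreover have "flip h x y < flip h x x" if "edge y x" for y
      using Cons.prems(4) that unfolding balanced_def by (auto simp: flip_def dynkin_edge_def)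
    ultimately show ?thesis by (auto simp: sorted_wrt_append)
  qed
  ultimately have "source_seq (flip h x) xs"
    using Cons.IH balanced_flip[OF Cons.prems(4) src] Cons.prems(5) by simp
  then show ?case using src by simp
qed simp

text \<open>The height of a letter is its position in \<open>zs\<close>, counted from 0.\<close>

lemma ex_height:
  assumes "distinct zs"
  shows "\<exists>h :: nat \<Rightarrow> nat. sorted_wrt (\<lambda>y z. h y < h z) zs \<and> inj_on h (set zs) \<and> (\<forall>v\<in>set zs. h v < length zs)"
  using assms
proof (induction zs rule: rev_induct)
  case (snoc z zs)
  then obtain h :: "nat \<Rightarrow> nat" where h: "sorted_wrt (\<lambda>y z. h y < h z) zs" "inj_on h (set zs)"
    "\<forall>v\<in>set zs. h v < length zs" by auto
  have z: "z \<notin> set zs" using snoc.prems by simp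
  let ?h = "h(z := length zs)"
  have "sorted_wrt (\<lambda>y z. ?h y < ?h z) zs"
    using h(1) by (rule sorted_wrt_mono_rel[rotated]) (use z in auto)
  then have "sorted_wrt (\<lambda>y z. ?h y < ?h z) (zs @ [z])"
    using h(3) z by (auto simp: sorted_wrt_append)
  moreover have "inj_on ?h (set (zs @ [z]))"
  proof (rule inj_onI)
    fix a b assume ab: "a \<in> set (zs @ [z])" "b \<in> set (zs @ [z])" "?h a = ?h b"
    show "a = b"
      using ab h(3) inj_onD[OF h(2)] by (cases "a = z"; cases "b = z") fastforce+
  qed
  moreover have "\<forall>v\<in>set (zs @ [z]). ?h v < length (zs @ [z])" using h(3) by fastforce
  ultimately show ?case by blast
qed simp

end

theorem theorem4:
  fixes n :: nat and m :: "nat \<Rightarrow> nat \<Rightarrow> enat" and c xs :: "nat list"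
  assumes "coxeter_matrix n m"
    and "coxeter_infinite n m"
    and "irreducible_cox n m"
    and "coxeter_element n m c"
    and "admissible n m c xs"
  shows "reduced n m xs"
proof -
  interpret coxeter_system n m by unfold_locales fact
  obtain zs where zs: "perm_word n zs" "weq n m c zs"
    using assms(4) unfolding coxeter_element_def by blast
  then have P: "distinct zs" "set zs = {1..n}" unfolding perm_word_def by blast+
  then have len: "length zs = n" using distinct_card[OF P(1)] by simp
  obtain h :: "nat \<Rightarrow> nat" where h: "sorted_wrt (\<lambda>y z. h y < h z) zs" "inj_on h {1..n}" "\<forall>v\<in>{1..n}. h v < n"
    using ex_height[OF P(1)] unfolding P(2) len by blast
  \<comment> \<open>Positions are distinct and below \<open>n\<close>, so any two differ by less
    than the amount \<open>n\<close> of a flip.\<close>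
  have "balanced h"
    unfolding balanced_def
  proof (intro allI impI)
    fix i j assume "dynkin_edge n m i j"
    then have ij: "i \<in> {1..n}" "j \<in> {1..n}" "i \<noteq> j" by (simp_all add: dynkin_edge_def)
    then have "h i \<noteq> h j" using inj_onD[OF h(2)] by blast
    moreover have "h i < n" using h(3) ij(1) by blast
    ultimately show "h i \<noteq> h j \<and> h i < h j + n" by simp
  qed
  moreover have "sorted_wrt (\<lambda>y z. dynkin_edge n m y z \<longrightarrow> h y < h z) zs"
    using h(1) by (rule sorted_wrt_mono_rel[rotated]) simp
  ultimately show ?thesis
    using source_seq_red[OF assms(3,2)] admissible_source_seq[OF zs _ _ assms(5)] by simp
qed

end
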